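(* Let $\mathcal{F}_2$ be the class of all permutations that are sums $\delta_{a_1}\oplus\cdots\oplus\delta_{a_m}$ of decreasing permutations with every $a_i\in\{1,2\}$ (i.e. layered permutations with all layers of size $1$ or $2$). Then $\mathcal{F}_2$ is not composable.
   Context: A permutation of order $n$ is a bijection $\pi:[n]\to[n]$, where $[n]=\{1,\dots,n\}$, also viewed as the sequence $\pi(1),\dots,\pi(n)$; the empty permutation is allowed. A permutation $\pi$ is contained in $\sigma$ if $\sigma$ has a (not necessarily contiguous) subsequence in the same relative order as $\pi$. A permutation class is a set of permutations closed downwards under containment. For permutations of the same order, $(\pi\circ\sigma)(i)=\pi(\sigma(i))$. For permutation classes, $\mathcal{A}\circ\mathcal{B}=\{\pi\circ\varphi : \pi\in\mathcal{A},\varphi\in\mathcal{B},|\pi|=|\varphi|\}$; this is an associative operation on permutation classes. A class $\mathcal{C}$ is $k$-composable if there are permutation classes $\mathcal{C}_1,\dots,\mathcal{C}_k\subsetneq\mathcal{C}$ (repetitions allowed) with $\mathcal{C}\subseteq\mathcal{C}_1\circ\cdots\circ\mathcal{C}_k$; it is composable if it is $k$-composable for some $k\ge2$. The sum $\pi\oplus\sigma$ of $\pi$ of order $k$ and $\sigma$ of order $l$ is the permutation $\pi(1),\dots,\pi(k),\sigma(1)+k,\dots,\sigma(l)+k$. $\delta_a$ denotes the decreasing permutation $a,a-1,\dots,1$ of order $a$. *)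

theory Defs
  imports "HOL-Combinatorics.Multiset_Permutations" "HOL-Library.Sublist"
begin

text \<open>
  A permutation of order n is given by its sequence of values pi(1), ..., pi(n), i.e. as a
  list over \<open>{1..n}\<close>. Lists are indexed from 0, so pi(i) is \<open>p ! (i - 1)\<close>.
\<close>

definition is_permutation :: "nat list \<Rightarrow> bool" where
  "is_permutation p \<longleftrightarrow> p \<in> permutations_of_set {1..length p}"

definition order_isomorphic :: "nat list \<Rightarrow> nat list \<Rightarrow> bool" where
  "order_isomorphic xs ys \<longleftrightarrow> length xs = length ys \<and>
     (\<forall>i<length xs. \<forall>j<length xs. xs ! i < xs ! j \<longleftrightarrow> ys ! i < ys ! j)"

definition contained_in :: "nat list \<Rightarrow> nat list \<Rightarrow> bool" where
  "contained_in p q \<longleftrightarrow> (\<exists>xs. subseq xs q \<and> order_isomorphic xs p)"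

definition permutation_class :: "nat list set \<Rightarrow> bool" where
  "permutation_class C \<longleftrightarrow> (\<forall>p\<in>C. is_permutation p) \<and>
     (\<forall>q\<in>C. \<forall>p. is_permutation p \<and> contained_in p q \<longrightarrow> p \<in> C)"

definition perm_comp :: "nat list \<Rightarrow> nat list \<Rightarrow> nat list" where
  "perm_comp p q = map (\<lambda>i. p ! (i - 1)) q"

definition class_comp :: "nat list set \<Rightarrow> nat list set \<Rightarrow> nat list set" where
  "class_comp A B = {perm_comp p q | p q. p \<in> A \<and> q \<in> B \<and> length p = length q}"

text \<open>
  The empty composition is the class of all identity permutations, the neutral element
  of \<^const>\<open>class_comp\<close>.
\<close>

fun class_comp_list :: "nat list set list \<Rightarrow> nat list set" where
  "class_comp_list [] = {[1..<Suc n] | n. True}"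
| "class_comp_list [A] = A"
| "class_comp_list (A # B # Cs) = class_comp A (class_comp_list (B # Cs))"

definition k_composable :: "nat \<Rightarrow> nat list set \<Rightarrow> bool" where
  "k_composable k C \<longleftrightarrow> (\<exists>Cs. length Cs = k \<and>
     (\<forall>D\<in>set Cs. permutation_class D \<and> D \<subset> C) \<and> C \<subseteq> class_comp_list Cs)"

definition composable :: "nat list set \<Rightarrow> bool" where
  "composable C \<longleftrightarrow> (\<exists>k\<ge>2. k_composable k C)"

definition perm_sum :: "nat list \<Rightarrow> nat list \<Rightarrow> nat list" where
  "perm_sum p q = p @ map (\<lambda>v. v + length p) q"

definition decreasing_perm :: "nat \<Rightarrow> nat list" where
  "decreasing_perm a = rev [1..<Suc a]"

definition F2 :: "nat list set" where
  "F2 = {foldr perm_sum (map decreasing_perm as) [] | as. set as \<subseteq> {1, 2}}"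

end

(* A proper subclass of F2 misses some sigma in F2. Since sigma embeds into a sum of sufficiently
   many copies of 21, the number of layers of size 2 is bounded on the subclass, and hence so is
   the number of points that are moved. Numbers of moved points are subadditive under composition,
   so they are bounded on every composition of proper subclasses, but they are not bounded on F2. *)
theory Submission imports Defs begin

text \<open>Positions count from 0, so the entry at a fixed position \<open>i\<close> is
  \<open>Suc i\<close>.\<close>

definition moved :: "nat list \<Rightarrow> nat set" where
  "moved p = {i. i < length p \<and> p ! i \<noteq> Suc i}"

text \<open>Layer sizes are arbitrary here, not only 1 and 2. Allowing size 0 lets the deletion of a
  layer be expressed as shrinking it.\<close>

definition layered :: "nat list \<Rightarrow> nat list" where
  "layered as = foldr perm_sum (map decreasing_perm as) []"

lemma layered_simps [simp]:
  "layered [] = []"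
  "layered (a # as) = perm_sum (decreasing_perm a) (layered as)"
  by (simp_all add: layered_def)

lemma F2_eq: "F2 = layered ` {as. set as \<subseteq> {1, 2}}"
  by (auto simp: F2_def layered_def)

lemma length_decreasing_perm [simp]: "length (decreasing_perm a) = a"
  by (simp add: decreasing_perm_def)

lemma is_permutation_iff: "is_permutation p \<longleftrightarrow> distinct p \<and> set p = {1..length p}"
  by (auto simp: is_permutation_def permutations_of_set_def)

lemma permutation_classD:
  assumes "permutation_class C" and "q \<in> C" and "is_permutation p" and "contained_in p q"
  shows "p \<in> C"
  using assms unfolding permutation_class_def by blast

lemma is_permutation_decreasing_perm: "is_permutation (decreasing_perm a)"
  by (auto simp: is_permutation_iff decreasing_perm_def)

lemma is_permutation_perm_sum:
  assumes "is_permutation p" and "is_permutation q"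
  shows "is_permutation (perm_sum p q)"
proof -
  have "set (perm_sum p q) = {1..length p} \<union> (\<lambda>v. v + length p) ` {1..length q}"
    using assms by (simp add: is_permutation_iff perm_sum_def)
  also have "\<dots> = {1..length p} \<union> {1 + length p..length q + length p}"
    by (simp only: image_add_atLeastAtMost')
  also have "\<dots> = {1..length (perm_sum p q)}"
    by (auto simp: perm_sum_def)
  finally show ?thesis
    using assms by (auto simp: is_permutation_iff perm_sum_def distinct_map)
qed

lemma is_permutation_layered: "is_permutation (layered as)"
  by (induction as)
    (simp_all add: is_permutation_perm_sum is_permutation_decreasing_perm, simp add: is_permutation_iff)

text \<open>The shift \<open>n\<close> is independent of \<open>length p\<close> because
  \<open>xs\<close> and \<open>ys\<close> will be subsequences of larger permutations, where the
  second block is shifted by the length of the larger first summand.\<close>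

lemma order_isomorphic_perm_sum:
  assumes "order_isomorphic xs p" and "order_isomorphic ys q"
    and "\<forall>x\<in>set xs. x \<le> n" and "\<forall>y\<in>set ys. 0 < y"
    and "is_permutation p" and "is_permutation q"
  shows "order_isomorphic (xs @ map (\<lambda>v. v + n) ys) (perm_sum p q)"
proof -
  have len: "length xs = length p" "length ys = length q"
    using assms by (auto simp: order_isomorphic_def)
  have "\<forall>x\<in>set p. x \<le> length p" "\<forall>y\<in>set q. 0 < y"
    using assms(5,6) by (simp_all add: is_permutation_iff)
  then have xs: "xs ! i \<le> n" "p ! i \<le> length p" if "i < length p" for i
    using assms(3) that len by simp_all
  have ys: "0 < ys ! i" "0 < q ! i" if "i < length q" for i
    using assms(4) \<open>\<forall>y\<in>set q. 0 < y\<close> that len by simp_all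
  \<comment> \<open>In both lists the first block lies entirely below the shifted second block,
    which settles all comparisons between blocks.\<close>
  have cross: "xs ! i < ys ! j + n" "p ! i < q ! j + length p"
    if "i < length p" "j < length q" for i j
    using xs[OF that(1)] ys[OF that(2)] by linarith+
  show ?thesis
    unfolding order_isomorphic_def
  proof (intro conjI allI impI)
    fix i j
    assume i: "i < length (xs @ map (\<lambda>v. v + n) ys)" and j: "j < length (xs @ map (\<lambda>v. v + n) ys)"
    show "(xs @ map (\<lambda>v. v + n) ys) ! i < (xs @ map (\<lambda>v. v + n) ys) ! j \<longleftrightarrow>
      perm_sum p q ! i < perm_sum p q ! j"
    proof (cases "i < length p"; cases "j < length p")
      assume "i < length p" "j < length p"
      then show ?thesis
        using assms(1) len by (simp add: order_isomorphic_def perm_sum_def nth_append)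
    next
      assume "i < length p" "\<not> j < length p"
      then show ?thesis
        using j len cross[of i "j - length p"] by (simp add: perm_sum_def nth_append less_diff_conv2)
    next
      assume "\<not> i < length p" "j < length p"
      then show ?thesis
        using i len cross[of j "i - length p"] by (simp add: perm_sum_def nth_append less_diff_conv2)
    next
      assume "\<not> i < length p" "\<not> j < length p"
      then show ?thesis
        using i j assms(2) len by (simp add: order_isomorphic_def perm_sum_def nth_append less_diff_conv2)
    qed
  qed (simp add: len perm_sum_def)
qed

text \<open>Embeddings of the summands are concatenated, the second one shifted by
  \<open>length p'\<close>.\<close>

lemma contained_in_perm_sum:
  assumes "contained_in p p'" and "contained_in q q'"
    and "is_permutation p" "is_permutation p'" "is_permutation q" "is_permutation q'"
  shows "contained_in (perm_sum p q) (perm_sum p' q')"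
proof -
  obtain xs ys where sub: "subseq xs p'" "subseq ys q'"
    and iso: "order_isomorphic xs p" "order_isomorphic ys q"
    using assms(1,2) by (auto simp: contained_in_def)
  have "set xs \<subseteq> set p'" "set ys \<subseteq> set q'"
    using sub by (auto simp: subseq_conv_nths dest: in_set_nthsD)
  then have "\<forall>x\<in>set xs. x \<le> length p'" "\<forall>y\<in>set ys. 0 < y"
    using assms(4,6) by (auto simp: is_permutation_iff)
  then have "order_isomorphic (xs @ map (\<lambda>v. v + length p') ys) (perm_sum p q)"
    using iso assms by (intro order_isomorphic_perm_sum)
  moreover have "subseq (xs @ map (\<lambda>v. v + length p') ys) (perm_sum p' q')"
    using sub by (auto simp: perm_sum_def intro: list_emb_append_mono subseq_map)
  ultimately show ?thesis
    by (auto simp: contained_in_def)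
qed

text \<open>The last \<open>a\<close> entries of \<delta>_b are literally \<delta>_a, so a suffix
  serves as the subsequence.\<close>

lemma contained_in_decreasing_perm:
  assumes "a \<le> b"
  shows "contained_in (decreasing_perm a) (decreasing_perm b)"
proof -
  have "[1..<Suc b] = [1..<Suc a] @ [Suc a..<Suc b]"
    using assms upt_add_eq_append[of 1 "Suc a" "b - a"] by simp
  then have "decreasing_perm b = rev [Suc a..<Suc b] @ decreasing_perm a"
    by (simp add: decreasing_perm_def del: upt_Suc)
  then have "subseq (decreasing_perm a) (decreasing_perm b)"
    by (simp only: list_emb_append2 subseq_order.order_refl)
  then show ?thesis
    by (auto simp: contained_in_def order_isomorphic_def)
qed

text \<open>Each layer embeds in the corresponding larger layer. As sizes may be 0, this covers the
  deletion of layers too.\<close>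

lemma contained_in_layered:
  assumes "list_all2 (\<le>) as bs"
  shows "contained_in (layered as) (layered bs)"
  using assms
proof (induction rule: list_all2_induct)
  case Nil
  then show ?case by (auto simp: contained_in_def order_isomorphic_def)
next
  case (Cons a as b bs)
  then show ?case
    by (simp add: contained_in_perm_sum contained_in_decreasing_perm is_permutation_layered
        is_permutation_decreasing_perm)
qed

lemma layered_filter_positive: "layered (filter ((<) 0) as) = layered as"
  by (induction as) (auto simp: perm_sum_def decreasing_perm_def)

text \<open>In the second summand positions and values are shifted by the same amount, so fixed
  points stay fixed.\<close>

lemma card_moved_perm_sum: "card (moved (perm_sum p q)) = card (moved p) + card (moved q)"
proof -
  have "moved (perm_sum p q) = moved p \<union> (\<lambda>i. i + length p) ` moved q"
  proof (intro equalityI subsetI)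
    fix i assume i: "i \<in> moved (perm_sum p q)"
    show "i \<in> moved p \<union> (\<lambda>i. i + length p) ` moved q"
    proof (cases "i < length p")
      case True
      with i show ?thesis by (auto simp: moved_def perm_sum_def nth_append)
    next
      case False
      with i have "i - length p \<in> moved q"
        by (auto simp: moved_def perm_sum_def nth_append)
      with False show ?thesis by (intro UnI2 image_eqI[of _ _ "i - length p"]) auto
    qed
  qed (auto simp: moved_def perm_sum_def nth_append)
  moreover have "moved p \<inter> (\<lambda>i. i + length p) ` moved q = {}"
    by (auto simp: moved_def)
  moreover have "finite (moved p)" "finite (moved q)"
    by (simp_all add: moved_def)
  ultimately show ?thesis
    by (simp add: card_Un_disjoint card_image)
qed

text \<open>A position fixed by both factors is fixed by the composition.\<close>

lemma card_moved_perm_comp: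
  assumes "length p = length q"
  shows "card (moved (perm_comp p q)) \<le> card (moved p) + card (moved q)"
proof -
  have "moved (perm_comp p q) \<subseteq> moved p \<union> moved q"
    using assms by (auto simp: moved_def perm_comp_def)
  then have "card (moved (perm_comp p q)) \<le> card (moved p \<union> moved q)"
    by (rule card_mono[rotated]) (simp add: moved_def)
  also have "\<dots> \<le> card (moved p) + card (moved q)"
    by (rule card_Un_le)
  finally show ?thesis .
qed

text \<open>A layer of size 2 moves both of its points, a layer of size 1 moves none.\<close>

lemma card_moved_layered:
  assumes "set as \<subseteq> {1, 2}"
  shows "card (moved (layered as)) = 2 * count_list as 2"
proof -
  have "moved (decreasing_perm 1) = {}" and "moved (decreasing_perm 2) = {0, 1}"
    by (auto simp: moved_def decreasing_perm_def numeral_2_eq_2 less_Suc_eq nth_Cons' split: if_splits)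
  moreover have "moved [] = {}"
    by (simp add: moved_def)
  ultimately show ?thesis
    using assms by (induction as) (auto simp: card_moved_perm_sum)
qed

text \<open>Keep \<open>n\<close> of the layers of size 2 and shrink all others to size 0.\<close>

lemma replicate_two_contained_in_layered:
  assumes "n \<le> count_list as 2"
  shows "contained_in (layered (replicate n 2)) (layered as)"
proof -
  have "\<exists>bs. list_all2 (\<le>) bs as \<and> filter ((<) 0) bs = replicate n (2::nat)"
    using assms
  proof (induction as arbitrary: n)
    case Nil
    then show ?case by simp
  next
    case (Cons a as)
    show ?case
    \<comment> \<open>Greedy choice: the first \<open>n\<close> entries equal to 2 are kept, and
      every other entry becomes 0.\<close>
    proof (cases "a = 2 \<and> n > 0")
      case True
      with Cons.prems have "n - 1 \<le> count_list as 2" by simp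
      from Cons.IH[OF this] obtain bs
        where "list_all2 (\<le>) bs as" "filter ((<) 0) bs = replicate (n - 1) 2" by blast
      with True have "list_all2 (\<le>) (2 # bs) (a # as) \<and> filter ((<) 0) (2 # bs) = replicate n 2"
        by (cases n) auto
      then show ?thesis by blast
    next
      case False
      with Cons.prems have "n \<le> count_list as 2" by (auto split: if_splits)
      from Cons.IH[OF this] obtain bs
        where "list_all2 (\<le>) bs as" "filter ((<) 0) bs = replicate n 2" by blast
      then have "list_all2 (\<le>) (0 # bs) (a # as) \<and> filter ((<) 0) (0 # bs) = replicate n 2"
        by auto
      then show ?thesis by blast
    qed
  qed
  then show ?thesis
    by (metis contained_in_layered layered_filter_positive)
qed

text \<open>If \<open>D\<close> misses a permutation with \<open>n\<close> layers, no member of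
  \<open>D\<close> has \<open>n\<close> layers of size 2, which gives the bound
  \<open>2 * n\<close>.\<close>

lemma bounded_moved_proper_subclass:
  assumes "permutation_class D" and "D \<subset> F2"
  shows "\<exists>K. \<forall>p\<in>D. card (moved p) \<le> K"
proof -
  from assms(2) obtain as where as: "set as \<subseteq> {1, 2}" "layered as \<notin> D"
    by (auto simp: F2_eq)
  define n where "n = length as"
  \<comment> \<open>Enlarging every layer to size 2 turns the missing permutation into a missing sum
    of copies of \<delta>_2.\<close>
  have "list_all2 (\<le>) as (replicate n 2)"
    using as(1) unfolding n_def by (induction as) auto
  then have "contained_in (layered as) (layered (replicate n 2))"
    by (rule contained_in_layered)
  with as(2) have notin: "layered (replicate n 2) \<notin> D"
    using permutation_classD[OF assms(1)] is_permutation_layered by blast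
  have "card (moved p) \<le> 2 * n" if "p \<in> D" for p
  proof -
    from that assms(2) obtain bs where bs: "set bs \<subseteq> {1, 2}" "p = layered bs"
      by (auto simp: F2_eq)
    \<comment> \<open>Otherwise downward closure would put \<open>layered (replicate n 2)\<close>
      into \<open>D\<close>.\<close>
    have "\<not> n \<le> count_list bs 2"
      using permutation_classD[OF assms(1) that is_permutation_layered] notin
        replicate_two_contained_in_layered[of n bs] bs(2) by blast
    then show ?thesis
      using card_moved_layered[OF bs(1)] bs(2) by simp
  qed
  then show ?thesis by blast
qed

text \<open>The bounds of the factors add up along the list; the identities of the empty composition
  move nothing.\<close>

lemma bounded_moved_class_comp_list:
  assumes "\<forall>D\<in>set Cs. \<exists>K. \<forall>p\<in>D. card (moved p) \<le> K"
  shows "\<exists>K. \<forall>p\<in>class_comp_list Cs. card (moved p) \<le> K"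
  using assms
proof (induction Cs rule: class_comp_list.induct)
  case 1
  have "moved [1..<Suc n] = {}" for n
    by (auto simp: moved_def simp del: upt_Suc)
  then show ?case by (auto simp del: upt_Suc)
next
  case (2 A)
  then show ?case by simp
next
  case (3 A B Cs)
  then obtain K L where "\<forall>p\<in>A. card (moved p) \<le> K"
    and "\<forall>p\<in>class_comp_list (B # Cs). card (moved p) \<le> L"
    by (metis list.set_intros)
  then have "\<forall>p\<in>class_comp A (class_comp_list (B # Cs)). card (moved p) \<le> K + L"
    unfolding class_comp_def by (auto intro!: order.trans[OF card_moved_perm_comp] add_mono)
  then show ?case by auto
qed

theorem theorem5p2: "\<not> composable F2"
proof
  assume "composable F2"
  then obtain Cs where "\<forall>D\<in>set Cs. permutation_class D \<and> D \<subset> F2" and F2: "F2 \<subseteq> class_comp_list Cs"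
    by (auto simp: composable_def k_composable_def)
  then obtain K where K: "\<forall>p\<in>class_comp_list Cs. card (moved p) \<le> K"
    using bounded_moved_class_comp_list bounded_moved_proper_subclass by meson
  \<comment> \<open>This sum of \<open>Suc K\<close> copies of \<delta>_2 moves
    \<open>2 * Suc K\<close> points, more than the bound \<open>K\<close> allows.\<close>
  let ?as = "replicate (Suc K) 2 :: nat list"
  have "layered ?as \<in> F2"
    unfolding F2_eq by (rule imageI) auto
  with F2 K have "card (moved (layered ?as)) \<le> K"
    by blast
  moreover have "count_list (replicate n 2) (2::nat) = n" for n
    by (induction n) auto
  then have "card (moved (layered ?as)) = 2 * Suc K"
    using card_moved_layered[of ?as] by (simp del: replicate_Suc add: set_replicate_Suc)
  ultimately show False by simp
qed

end
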